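(* Let $\mathbf{Q}$, $\mathbf{A}$, $\mathbf{B}$, $\mathbf{S}$ be as in the context; in particular $\partial_t \mathbf{Q} = -\mathbf{A}(x,t)\,\partial_x \mathbf{Q} + \mathbf{S}(\mathbf{Q})$, with $\mathbf{B}(x,t)$ the Jacobian matrix of $\mathbf{S}$ evaluated at $\mathbf{Q}(x,t)$. For integers $l\ge 1$ and $1\le k\le l+1$ set $$\mathbf{D}(l+1,k) = \binom{l-1}{l-k}\mathbf{B}_x^{(l-k)} - \binom{l}{l+1-k}\mathbf{A}_x^{(l+1-k)},$$ where $\binom{n}{-1}=0$ for every integer $n$ (so the $\mathbf{B}$-term is absent when $k=l+1$). Define matrix functions $\mathbf{C}(k,l)$ recursively by $\mathbf{C}(k,0)=\mathbf{0}$ for all $k>0$, $\mathbf{C}(1,1)=-\mathbf{A}$, and, for $k\ge 2$ and $1\le l\le k$, $$\mathbf{C}(k,l)=\begin{cases}\mathbf{C}(k-1,k-1)\,\mathbf{D}(k,k), & l=k,\\[2pt] \partial_t\mathbf{C}(k-1,l)+\displaystyle\sum_{m=l-1}^{k-1}\mathbf{C}(k-1,m)\,\mathbf{D}(m+1,l), & l<k,\end{cases}$$ where a term with $m=0$ is zero because $\mathbf{C}(k-1,0)=\mathbf{0}$. Then for every integer $k\ge 1$, $$\partial_t^{(k)}\mathbf{Q}=\sum_{l=1}^{k}\mathbf{C}(k,l)\,\partial_x^{(l)}\mathbf{Q}+\partial_t^{(k-2)}\bigl(\mathbf{B}\,\partial_t\mathbf{Q}\bigr),$$ where for $k=1$ the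 convention $\partial_t^{(-1)}(\mathbf{B}\,\partial_t\mathbf{Q})=\mathbf{S}(\mathbf{Q})$ is used.
   Context: Let $m_0\ge 1$ be an integer and $\Omega\subseteq\mathbb{R}^2$ an open set with coordinates $(x,t)$. Let $\mathbf{S}:\mathbb{R}^{m_0}\to\mathbb{R}^{m_0}$ be a smooth function (the source term), $\mathbf{A}:\Omega\to\mathbb{R}^{m_0\times m_0}$ a smooth matrix-valued function of $(x,t)$, and $\mathbf{Q}:\Omega\to\mathbb{R}^{m_0}$ a smooth function satisfying $$\partial_t \mathbf{Q}(x,t) = -\mathbf{A}(x,t)\,\partial_x\mathbf{Q}(x,t)+\mathbf{S}(\mathbf{Q}(x,t))\quad\text{on }\Omega.$$ Let $\mathbf{B}(x,t)$ be the Jacobian matrix of $\mathbf{S}$ with respect to $\mathbf{Q}$, evaluated at $\mathbf{Q}(x,t)$ and regarded as a matrix function of $(x,t)$; thus $\partial_x(\mathbf{S}(\mathbf{Q}))=\mathbf{B}\,\partial_x\mathbf{Q}$ and $\partial_t(\mathbf{S}(\mathbf{Q}))=\mathbf{B}\,\partial_t\mathbf{Q}$. Notation: $\partial_x^{(j)}$ and $\partial_t^{(j)}$ denote the $j$-th partial derivatives in $x$ and $t$, with $\partial_x^{(0)}$ and $\partial_t^{(0)}$ the identity; for a matrix function $\mathbf{M}$, $\mathbf{M}_x^{(j)}=\partial_x^{(j)}\mathbf{M}$. Products of matrices are matrix products in the order written. *)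

theory Defs
  imports "HOL-Analysis.Analysis"
begin

(* C^n regularity through iterated directional derivatives; intended for open sets U. *)
primrec C_n_on :: "nat \<Rightarrow> ('a::real_normed_vector \<Rightarrow> 'b::real_normed_vector) \<Rightarrow> 'a set \<Rightarrow> bool" where
  "C_n_on 0 f U \<longleftrightarrow> continuous_on U f"
| "C_n_on (Suc n) f U \<longleftrightarrow>
     (\<forall>x\<in>U. f differentiable (at x)) \<and>
     (\<forall>v. C_n_on n (\<lambda>x. frechet_derivative f (at x) v) U)"

definition smooth_on :: "('a::real_normed_vector \<Rightarrow> 'b::real_normed_vector) \<Rightarrow> 'a set \<Rightarrow> bool" where
  "smooth_on f U \<longleftrightarrow> (\<forall>n. C_n_on n f U)"

(* Functions of (x, t) are total on real \<times> real; at points of an open set, iterated partial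
   derivatives depend only on the values of the function on that set. *)
definition partial_x :: "(real \<times> real \<Rightarrow> 'a::real_normed_vector) \<Rightarrow> real \<times> real \<Rightarrow> 'a" where
  "partial_x f = (\<lambda>(x, t). vector_derivative (\<lambda>s. f (s, t)) (at x))"

definition partial_t :: "(real \<times> real \<Rightarrow> 'a::real_normed_vector) \<Rightarrow> real \<times> real \<Rightarrow> 'a" where
  "partial_t f = (\<lambda>(x, t). vector_derivative (\<lambda>s. f (x, s)) (at t))"

(* coeff_D A B n k is D(n, k) for n = l + 1 \<ge> 2 and 1 \<le> k \<le> n. The conditional implements
   (l-1 choose -1) = 0 in the case k = l + 1, where l - k is truncated to 0 on nat. *)
definition coeff_D ::
  "(real \<times> real \<Rightarrow> real^'n^'n) \<Rightarrow> (real \<times> real \<Rightarrow> real^'n^'n) \<Rightarrow> nat \<Rightarrow> nat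
     \<Rightarrow> real \<times> real \<Rightarrow> real^'n^'n" where
  "coeff_D A B n k p = (let l = n - 1 in
     (if k \<le> l then real ((l - 1) choose (l - k)) *\<^sub>R (partial_x ^^ (l - k)) B p else 0)
     - real (l choose (l + 1 - k)) *\<^sub>R (partial_x ^^ (l + 1 - k)) A p)"

(* The values for k = 0 and for l > k, which the recursion leaves open, are set to 0 and never used.
   For l = 1 the sum includes m = 0, where coeff_C A B (k - 1) 0 = 0, so that the value of
   coeff_D A B 1 1 is irrelevant. *)
fun coeff_C ::
  "(real \<times> real \<Rightarrow> real^'n^'n) \<Rightarrow> (real \<times> real \<Rightarrow> real^'n^'n) \<Rightarrow> nat \<Rightarrow> nat
     \<Rightarrow> real \<times> real \<Rightarrow> real^'n^'n" where
  "coeff_C A B 0 l = (\<lambda>p. 0)"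
| "coeff_C A B (Suc 0) l = (if l = 1 then (\<lambda>p. - A p) else (\<lambda>p. 0))"
| "coeff_C A B (Suc (Suc j)) l =
     (let k = Suc (Suc j) in
      if l = 0 \<or> k < l then (\<lambda>p. 0)
      else if l = k then (\<lambda>p. coeff_C A B (Suc j) (Suc j) p ** coeff_D A B k k p)
      else (\<lambda>p. partial_t (coeff_C A B (Suc j) l) p
                + (\<Sum>m = l - 1..k - 1. coeff_C A B (Suc j) m p ** coeff_D A B (m + 1) l p)))"

end

theory Submission
  imports Defs
begin

text \<open>
  For \<open>m \<ge> 1\<close>, mixed partial derivatives commute, so \<open>\<partial>\<^sub>t \<partial>\<^sub>x\<^sup>m Q = \<partial>\<^sub>x\<^sup>m (S(Q)) - \<partial>\<^sub>x\<^sup>m (A \<partial>\<^sub>x Q)\<close>.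
  One \<open>x\<close>-derivative turns \<open>S(Q)\<close> into \<open>B \<partial>\<^sub>x Q\<close>, and the Leibniz rule for the remaining
  \<open>m - 1\<close> derivatives of \<open>B \<partial>\<^sub>x Q\<close> and the \<open>m\<close> derivatives of \<open>A \<partial>\<^sub>x Q\<close> gives
  \<open>\<partial>\<^sub>t \<partial>\<^sub>x\<^sup>m Q = (\<Sum>l = 1..m + 1. D(m + 1, l) \<partial>\<^sub>x\<^sup>l Q)\<close>. Differentiating the expansion of
  \<open>\<partial>\<^sub>t\<^sup>k Q\<close> in \<open>t\<close>, inserting this and collecting the coefficient of each \<open>\<partial>\<^sub>x\<^sup>l Q\<close> yields
  the recursion for \<open>C(k, l)\<close>.
\<close>

section \<open>Closure properties of smooth functions\<close>

lemma frechet_derivative_cong_open: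
  assumes "open U" "x \<in> U" "\<And>y. y \<in> U \<Longrightarrow> f y = g y" "f differentiable (at x)"
  shows "frechet_derivative f (at x) = frechet_derivative g (at x)"
  using frechet_derivative_transform_within_open[of f x U g] assms by simp

lemma differentiable_cong_open:
  assumes "open U" "x \<in> U" "\<And>y. y \<in> U \<Longrightarrow> f y = g y" "f differentiable (at x)"
  shows "g differentiable (at x)"
  using assms has_derivative_transform_within_open[of f _ x UNIV U g]
  unfolding differentiable_def by metis

text \<open>On an open set the derivative at a point depends only on values inside the set, so
  agreement passes to directional derivatives. Both functions are generalized because the induction
  step replaces them by these.\<close>

lemma C_n_on_cong:
  assumes "open U" "\<And>x. x \<in> U \<Longrightarrow> f x = g x" "C_n_on n f U"
  shows "C_n_on n g U"
  using assms(2,3)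
proof (induction n arbitrary: f g)
  case 0
  then show ?case using continuous_on_cong[of U U f g] by simp
next
  case (Suc n)
  have "g differentiable (at x)" if "x \<in> U" for x
    using differentiable_cong_open[OF assms(1) that, of f g] Suc.prems that by simp
  moreover have "C_n_on n (\<lambda>x. frechet_derivative g (at x) v) U" for v
  proof (rule Suc.IH)
    show "C_n_on n (\<lambda>x. frechet_derivative f (at x) v) U" using Suc.prems by simp
    show "frechet_derivative f (at x) v = frechet_derivative g (at x) v" if "x \<in> U" for x
      using frechet_derivative_cong_open[OF assms(1) that, of f g] Suc.prems that by simp
  qed
  ultimately show ?case by simp
qed

text \<open>By uniqueness of the derivative, any explicit formula \<open>f'\<close> agrees on
  \<open>U\<close> with the \<open>frechet_derivative\<close> in the definition. The closure proofs
  below can therefore work with the usual differentiation rules.\<close>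

lemma C_n_on_SucI:
  assumes "open U"
    and "\<And>x. x \<in> U \<Longrightarrow> (f has_derivative f' x) (at x)"
    and "\<And>v. C_n_on n (\<lambda>x. f' x v) U"
  shows "C_n_on (Suc n) f U"
proof -
  have "f' x = frechet_derivative f (at x)" if "x \<in> U" for x
    using frechet_derivative_at assms(2) that by blast
  then have "C_n_on n (\<lambda>x. frechet_derivative f (at x) v) U" for v
    using C_n_on_cong[OF assms(1) _ assms(3)[of v]] by simp
  then show ?thesis using assms(2) by (auto intro: differentiableI)
qed

text \<open>Differentiability gives continuity at order 0; at higher orders the same descent applies
  to each directional derivative.\<close>

lemma C_n_on_SucD:
  assumes "C_n_on (Suc n) f U"
  shows "C_n_on n f U"
  using assms
proof (induction n arbitrary: f)
  case 0
  then show ?case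
    by (auto intro!: continuous_at_imp_continuous_on differentiable_imp_continuous_within)
next
  case (Suc n)
  then show ?case by auto
qed

lemma C_n_on_Suc_has_derivative:
  "C_n_on (Suc n) f U \<Longrightarrow> x \<in> U \<Longrightarrow> (f has_derivative frechet_derivative f (at x)) (at x)"
  by (simp add: frechet_derivative_works[symmetric])

lemma C_n_on_const: "C_n_on n (\<lambda>x. c) U"
  by (induction n arbitrary: c) auto

lemma C_n_on_add:
  assumes "open U" "C_n_on n f U" "C_n_on n g U"
  shows "C_n_on n (\<lambda>x. f x + g x) U"
  using assms(2,3)
proof (induction n arbitrary: f g)
  case 0
  then show ?case by (simp add: continuous_on_add)
next
  case (Suc n)
  show ?case
    by (rule C_n_on_SucI[OF assms(1) has_derivative_add[OF
            Suc.prems[THEN C_n_on_Suc_has_derivative]] Suc.IH])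
      (use Suc.prems in auto)
qed

lemma C_n_on_bounded_linear:
  assumes "open U" "bounded_linear L" "C_n_on n f U"
  shows "C_n_on n (\<lambda>x. L (f x)) U"
  using assms(3)
proof (induction n arbitrary: f)
  case 0
  then show ?case using bounded_linear.continuous_on[OF assms(2)] by simp
next
  case (Suc n)
  show ?case
    by (rule C_n_on_SucI[OF assms(1) bounded_linear.has_derivative[OF assms(2)
            Suc.prems[THEN C_n_on_Suc_has_derivative]] Suc.IH])
      (use Suc.prems in auto)
qed

lemma C_n_on_bounded_bilinear:
  assumes "open U" "bounded_bilinear prd" "C_n_on n f U" "C_n_on n g U"
  shows "C_n_on n (\<lambda>x. prd (f x) (g x)) U"
  using assms(3,4)
proof (induction n arbitrary: f g)
  case 0
  then show ?case using bounded_bilinear.continuous_on[OF assms(2)] by simp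
next
  case (Suc n)
  \<comment> \<open>Each summand of the product rule keeps one factor undifferentiated; lowering its
    order by one makes the induction hypothesis applicable.\<close>
  note D = Suc.prems[THEN C_n_on_SucD]
  show ?case
  proof (rule C_n_on_SucI[OF assms(1)])
    fix x assume "x \<in> U"
    then show "((\<lambda>x. prd (f x) (g x)) has_derivative
        (\<lambda>h. prd (f x) (frechet_derivative g (at x) h) + prd (frechet_derivative f (at x) h) (g x))) (at x)"
      by (intro bounded_bilinear.FDERIV[OF assms(2)] Suc.prems[THEN C_n_on_Suc_has_derivative])
  next
    fix v
    show "C_n_on n (\<lambda>x. prd (f x) (frechet_derivative g (at x) v)
        + prd (frechet_derivative f (at x) v) (g x)) U"
      using Suc.prems D by (intro C_n_on_add assms(1) Suc.IH) auto
  qed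
qed

lemma C_n_on_sum:
  assumes "open U" "\<And>i. i \<in> I \<Longrightarrow> C_n_on n (f i) U"
  shows "C_n_on n (\<lambda>x. \<Sum>i\<in>I. f i x) U"
  using assms(2)
  by (induction I rule: infinite_finite_induct) (auto intro!: C_n_on_const C_n_on_add assms(1))

text \<open>The chain rule evaluates the derivative of \<open>f\<close> in a direction that varies
  with \<open>x\<close>, while \<open>C_n_on\<close> controls fixed directions only. Expanding that
  direction in the finite \<open>Basis\<close> leaves products of scalar coefficients with
  derivatives in fixed directions.\<close>

lemma C_n_on_compose:
  fixes f :: "'b::euclidean_space \<Rightarrow> 'c::real_normed_vector"
  assumes "open U" "open V" "g ` U \<subseteq> V" "C_n_on n f V" "C_n_on n g U"
  shows "C_n_on n (\<lambda>x. f (g x)) U"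
  using assms(4,5)
proof (induction n arbitrary: f)
  case 0
  then show ?case using continuous_on_compose2[of V f U g] assms(3) by simp
next
  case (Suc n)
  have g': "(g has_derivative frechet_derivative g (at x)) (at x)" if "x \<in> U" for x
    using Suc.prems(2) that by (rule C_n_on_Suc_has_derivative)
  have f': "(f has_derivative frechet_derivative f (at (g x))) (at (g x))" if "x \<in> U" for x
    using Suc.prems(1) by (rule C_n_on_Suc_has_derivative) (use that assms(3) in auto)
  show ?case
  proof (rule C_n_on_SucI[OF assms(1)])
    fix x assume "x \<in> U"
    then show "((\<lambda>x. f (g x)) has_derivative
        (\<lambda>h. frechet_derivative f (at (g x)) (frechet_derivative g (at x) h))) (at x)"
      using has_derivative_compose[OF g' f'] by simp
  next
    fix v
    have "C_n_on n (\<lambda>x. \<Sum>b\<in>Basis. (frechet_derivative g (at x) v \<bullet> b) *\<^sub>R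
        frechet_derivative f (at (g x)) b) U"
    proof (intro C_n_on_sum assms(1) C_n_on_bounded_bilinear[OF _ bounded_bilinear_scaleR]
        C_n_on_bounded_linear[OF _ bounded_linear_inner_left])
      show "C_n_on n (\<lambda>x. frechet_derivative g (at x) v) U"
        using Suc.prems by simp
      \<comment> \<open>Again a composition with \<open>g\<close>, now with the outer function
        \<open>f\<close> differentiated along \<open>b\<close>; hence the induction over arbitrary
        \<open>f\<close>.\<close>
      show "C_n_on n (\<lambda>x. frechet_derivative f (at (g x)) b) U" for b
        using Suc.prems C_n_on_SucD by (intro Suc.IH) auto
    qed
    moreover have "(\<Sum>b\<in>Basis. (frechet_derivative g (at x) v \<bullet> b) *\<^sub>R
        frechet_derivative f (at (g x)) b) = frechet_derivative f (at (g x)) (frechet_derivative g (at x) v)"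
      if "x \<in> U" for x
    proof -
      have "linear (frechet_derivative f (at (g x)))"
        using f'[OF that] by (rule has_derivative_linear)
      from linear_sum[OF this] linear_scale[OF this] show ?thesis
        by (metis (no_types, lifting) euclidean_representation sum.cong)
    qed
    ultimately show "C_n_on n (\<lambda>x. frechet_derivative f (at (g x)) (frechet_derivative g (at x) v)) U"
      using C_n_on_cong[OF assms(1)] by (metis (no_types, lifting))
  qed
qed

lemma smooth_on_cong:
  "open U \<Longrightarrow> (\<And>x. x \<in> U \<Longrightarrow> f x = g x) \<Longrightarrow> smooth_on f U \<Longrightarrow> smooth_on g U"
  unfolding smooth_on_def using C_n_on_cong by blast

lemma smooth_on_const: "smooth_on (\<lambda>x. c) U"
  by (simp add: smooth_on_def C_n_on_const)

lemma smooth_on_add: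
  "open U \<Longrightarrow> smooth_on f U \<Longrightarrow> smooth_on g U \<Longrightarrow> smooth_on (\<lambda>x. f x + g x) U"
  by (simp add: smooth_on_def C_n_on_add)

lemma smooth_on_sum:
  "open U \<Longrightarrow> (\<And>i. i \<in> I \<Longrightarrow> smooth_on (f i) U) \<Longrightarrow> smooth_on (\<lambda>x. \<Sum>i\<in>I. f i x) U"
  by (simp add: smooth_on_def C_n_on_sum)

lemma smooth_on_bounded_linear:
  "open U \<Longrightarrow> bounded_linear L \<Longrightarrow> smooth_on f U \<Longrightarrow> smooth_on (\<lambda>x. L (f x)) U"
  by (simp add: smooth_on_def C_n_on_bounded_linear)

lemmas smooth_on_minus = smooth_on_bounded_linear[OF _ bounded_linear_minus[OF bounded_linear_ident]]
lemmas smooth_on_scaleR = smooth_on_bounded_linear[OF _ bounded_linear_scaleR_right]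

lemma smooth_on_diff:
  "open U \<Longrightarrow> smooth_on f U \<Longrightarrow> smooth_on g U \<Longrightarrow> smooth_on (\<lambda>x. f x - g x) U"
  using smooth_on_add[of U f "\<lambda>x. - g x"] smooth_on_minus[of U g] by simp

lemma smooth_on_bounded_bilinear:
  "open U \<Longrightarrow> bounded_bilinear prd \<Longrightarrow> smooth_on f U \<Longrightarrow> smooth_on g U
    \<Longrightarrow> smooth_on (\<lambda>x. prd (f x) (g x)) U"
  by (simp add: smooth_on_def C_n_on_bounded_bilinear)

lemma smooth_on_compose:
  fixes f :: "'b::euclidean_space \<Rightarrow> 'c::real_normed_vector"
  shows "open U \<Longrightarrow> open V \<Longrightarrow> g ` U \<subseteq> V \<Longrightarrow> smooth_on f V \<Longrightarrow> smooth_on g U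
    \<Longrightarrow> smooth_on (\<lambda>x. f (g x)) U"
  by (simp add: smooth_on_def C_n_on_compose)

lemma smooth_on_has_derivative:
  "smooth_on f U \<Longrightarrow> x \<in> U \<Longrightarrow> (f has_derivative frechet_derivative f (at x)) (at x)"
  using C_n_on_Suc_has_derivative unfolding smooth_on_def by blast

lemma smooth_on_frechet_derivative:
  "smooth_on f U \<Longrightarrow> smooth_on (\<lambda>x. frechet_derivative f (at x) v) U"
  unfolding smooth_on_def using C_n_on.simps(2) by blast

lemma smooth_on_imp_continuous_on: "smooth_on f U \<Longrightarrow> continuous_on U f"
  unfolding smooth_on_def using C_n_on.simps(1) by blast

section \<open>Matrix products and Jacobian matrices\<close>

lemma bounded_bilinear_matrix_vector_mult:
  "bounded_bilinear ((*v) :: real^'n^'m \<Rightarrow> real^'n \<Rightarrow> real^'m)"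
  unfolding bilinear_conv_bounded_bilinear[symmetric] bilinear_def
  by (auto intro!: linearI simp: algebra_simps matrix_vector_mult_scaleR scaleR_matrix_vector_assoc)

lemma bounded_bilinear_matrix_matrix_mult:
  "bounded_bilinear ((**) :: real^'n^'m \<Rightarrow> real^'p^'n \<Rightarrow> real^'p^'m)"
  unfolding bilinear_conv_bounded_bilinear[symmetric] bilinear_def
  by (intro conjI allI linearI)
    (simp_all add: matrix_matrix_mult_def vec_eq_iff distrib_left distrib_right sum.distrib
      sum_distrib_left mult_ac)

lemma smooth_on_jacobian:
  fixes f :: "real^'n \<Rightarrow> real^'m"
  assumes "open U" "smooth_on f U"
  shows "smooth_on (\<lambda>x. jacobian f (at x)) U"
proof -
  \<comment> \<open>\<open>L j\<close> places a vector in column \<open>j\<close>, so the Jacobian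
    is a finite sum of linear images of directional derivatives along the axes.\<close>
  define L :: "'n \<Rightarrow> real^'m \<Rightarrow> real^'n^'m"
    where "L j v = (\<chi> i k. if k = j then v $ i else 0)" for j v
  have L: "bounded_linear (L j)" for j
    unfolding linear_conv_bounded_linear[symmetric]
    by (intro linearI) (simp_all add: L_def vec_eq_iff)
  have "smooth_on (\<lambda>x. \<Sum>j\<in>UNIV. L j (frechet_derivative f (at x) (axis j 1))) U"
    by (rule smooth_on_sum[OF assms(1)
          smooth_on_bounded_linear[OF assms(1) L smooth_on_frechet_derivative[OF assms(2)]]])
  moreover have "(\<Sum>j\<in>UNIV. L j (frechet_derivative f (at x) (axis j 1))) = jacobian f (at x)" for x
    by (simp add: vec_eq_iff L_def jacobian_def matrix_def)
  ultimately show ?thesis by simp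
qed

section \<open>Partial derivatives\<close>

lemma has_derivative_imp_partial_vector_derivative:
  assumes "(f has_derivative f') (at (x, t))"
  shows "((\<lambda>s. f (s, t)) has_vector_derivative f' (1, 0)) (at x)"
    and "((\<lambda>s. f (x, s)) has_vector_derivative f' (0, 1)) (at t)"
proof -
  have lin: "linear f'" using assms by (rule has_derivative_linear)
  have "((\<lambda>s. f (s, t)) has_derivative (\<lambda>h. f' (h, 0))) (at x)"
    by (rule has_derivative_compose[OF has_derivative_Pair[OF has_derivative_ident
            has_derivative_const] assms])
  then show "((\<lambda>s. f (s, t)) has_vector_derivative f' (1, 0)) (at x)"
    by (simp add: has_vector_derivative_def flip: linear_scale[OF lin])
  have "((\<lambda>s. f (x, s)) has_derivative (\<lambda>h. f' (0, h))) (at t)"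
    by (rule has_derivative_compose[OF has_derivative_Pair[OF has_derivative_const
            has_derivative_ident] assms])
  then show "((\<lambda>s. f (x, s)) has_vector_derivative f' (0, 1)) (at t)"
    by (simp add: has_vector_derivative_def flip: linear_scale[OF lin])
qed

text \<open>Bridge from the one-variable definitions to total derivatives: every rule for
  \<open>partial_x\<close> and \<open>partial_t\<close> below is read off from a rule for
  \<open>has_derivative\<close>.\<close>

lemma partial_eq_frechet_derivative:
  assumes "(f has_derivative f') (at p)"
  shows "partial_x f p = f' (1, 0)" "partial_t f p = f' (0, 1)"
proof -
  obtain x t where p: "p = (x, t)" by (cases p)
  note * = has_derivative_imp_partial_vector_derivative[OF assms[unfolded p]]
  show "partial_x f p = f' (1, 0)" "partial_t f p = f' (0, 1)"
    using *[THEN vector_derivative_at] by (simp_all add: p partial_x_def partial_t_def)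
qed

lemma smooth_on_partial_eq:
  assumes "smooth_on f U" "p \<in> U"
  shows "partial_x f p = frechet_derivative f (at p) (1, 0)"
    and "partial_t f p = frechet_derivative f (at p) (0, 1)"
  using partial_eq_frechet_derivative[OF smooth_on_has_derivative[OF assms]] by auto

lemma smooth_on_has_vector_derivative_partial:
  assumes "smooth_on f U" "(x, t) \<in> U"
  shows "((\<lambda>s. f (s, t)) has_vector_derivative partial_x f (x, t)) (at x)"
    and "((\<lambda>s. f (x, s)) has_vector_derivative partial_t f (x, t)) (at t)"
  using has_derivative_imp_partial_vector_derivative[OF smooth_on_has_derivative[OF assms]]
  by (simp_all add: smooth_on_partial_eq[OF assms])

lemma smooth_on_partial:
  assumes "open U" "smooth_on f U"
  shows "smooth_on (partial_x f) U" "smooth_on (partial_t f) U"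
  by (rule smooth_on_cong[OF assms(1) _ smooth_on_frechet_derivative[OF assms(2)]],
      simp add: smooth_on_partial_eq[OF assms(2)])+

lemma smooth_on_funpow_partial:
  assumes "open U" "smooth_on f U"
  shows "smooth_on ((partial_x ^^ n) f) U" "smooth_on ((partial_t ^^ n) f) U"
  by (induction n) (auto intro: smooth_on_partial assms)

text \<open>Permits differentiating an identity known only on \<open>U\<close>, such as the
  differential equation or an induction hypothesis.\<close>

lemma partial_cong:
  assumes "open U" "smooth_on f U" "\<And>q. q \<in> U \<Longrightarrow> f q = g q" "p \<in> U"
  shows "partial_x f p = partial_x g p" "partial_t f p = partial_t g p"
  using frechet_derivative_cong_open[OF assms(1,4,3) differentiableI[OF
        smooth_on_has_derivative[OF assms(2,4)]]]
  by (simp_all add: smooth_on_partial_eq[OF assms(2,4)]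
      smooth_on_partial_eq[OF smooth_on_cong[OF assms(1,3,2)] assms(4)])

lemma funpow_partial_x_cong:
  assumes "open U" "smooth_on f U" "\<And>q. q \<in> U \<Longrightarrow> f q = g q" "p \<in> U"
  shows "(partial_x ^^ n) f p = (partial_x ^^ n) g p"
  using assms(4)
proof (induction n arbitrary: p)
  case 0
  then show ?case using assms(3) by simp
next
  case (Suc n)
  then show ?case
    using partial_cong(1)[OF assms(1) smooth_on_funpow_partial(1)[OF assms(1,2)]] by simp
qed

lemma partial_add:
  assumes "smooth_on f U" "smooth_on g U" "p \<in> U"
  shows "partial_x (\<lambda>q. f q + g q) p = partial_x f p + partial_x g p"
    and "partial_t (\<lambda>q. f q + g q) p = partial_t f p + partial_t g p"
  using partial_eq_frechet_derivative[OF has_derivative_add[OF assms(1,2)[THEN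
        smooth_on_has_derivative, OF assms(3)]]]
  by (simp_all add: smooth_on_partial_eq[OF assms(1,3)] smooth_on_partial_eq[OF assms(2,3)])

lemma partial_sum:
  assumes "\<And>i. i \<in> I \<Longrightarrow> smooth_on (f i) U" "p \<in> U"
  shows "partial_x (\<lambda>q. \<Sum>i\<in>I. f i q) p = (\<Sum>i\<in>I. partial_x (f i) p)"
    and "partial_t (\<lambda>q. \<Sum>i\<in>I. f i q) p = (\<Sum>i\<in>I. partial_t (f i) p)"
proof -
  have "((\<lambda>q. \<Sum>i\<in>I. f i q) has_derivative (\<lambda>h. \<Sum>i\<in>I. frechet_derivative (f i) (at p) h)) (at p)"
    using assms by (intro has_derivative_sum smooth_on_has_derivative)
  from partial_eq_frechet_derivative[OF this]
  show "partial_x (\<lambda>q. \<Sum>i\<in>I. f i q) p = (\<Sum>i\<in>I. partial_x (f i) p)"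
    and "partial_t (\<lambda>q. \<Sum>i\<in>I. f i q) p = (\<Sum>i\<in>I. partial_t (f i) p)"
    using assms by (simp_all add: smooth_on_partial_eq[where U = U])
qed

lemma partial_bounded_linear:
  assumes "bounded_linear L" "smooth_on f U" "p \<in> U"
  shows "partial_x (\<lambda>q. L (f q)) p = L (partial_x f p)"
    and "partial_t (\<lambda>q. L (f q)) p = L (partial_t f p)"
  using partial_eq_frechet_derivative[OF bounded_linear.has_derivative[OF assms(1)
        smooth_on_has_derivative[OF assms(2,3)]]]
  by (simp_all add: smooth_on_partial_eq[OF assms(2,3)])

lemma partial_bounded_bilinear:
  assumes "bounded_bilinear prd" "smooth_on f U" "smooth_on g U" "p \<in> U"
  shows "partial_x (\<lambda>q. prd (f q) (g q)) p = prd (partial_x f p) (g p) + prd (f p) (partial_x g p)"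
    and "partial_t (\<lambda>q. prd (f q) (g q)) p = prd (partial_t f p) (g p) + prd (f p) (partial_t g p)"
  using partial_eq_frechet_derivative[OF bounded_bilinear.FDERIV[OF assms(1)
        assms(2,3)[THEN smooth_on_has_derivative, OF assms(4)]]]
  by (simp_all add: smooth_on_partial_eq[OF assms(2,4)] smooth_on_partial_eq[OF assms(3,4)] add.commute)

section \<open>Higher x-derivatives and the Leibniz rule\<close>

lemma funpow_partial_x_diff:
  assumes "open U" "smooth_on f U" "smooth_on g U" "p \<in> U"
  shows "(partial_x ^^ n) (\<lambda>q. f q - g q) p = (partial_x ^^ n) f p - (partial_x ^^ n) g p"
  using assms(4)
proof (induction n arbitrary: p)
  case 0
  then show ?case by simp
next
  case (Suc n)
  note sm = smooth_on_funpow_partial(1)[OF assms(1)]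
  have "(partial_x ^^ Suc n) (\<lambda>q. f q - g q) p
      = partial_x (\<lambda>q. (partial_x ^^ n) f q - (partial_x ^^ n) g q) p"
    using partial_cong(1)[OF assms(1) sm[OF smooth_on_diff[OF assms(1-3)]] Suc.IH Suc.prems] by simp
  also have "\<dots> = partial_x (\<lambda>q. (partial_x ^^ n) f q + - (partial_x ^^ n) g q) p"
    by simp
  also have "\<dots> = (partial_x ^^ Suc n) f p - (partial_x ^^ Suc n) g p"
    using partial_add(1)[OF sm smooth_on_minus[OF assms(1) sm] Suc.prems, of f g]
      partial_bounded_linear(1)[OF bounded_linear_minus[OF bounded_linear_ident] sm Suc.prems, of g] assms
    by simp
  finally show ?case .
qed

text \<open>Pascal's rule in the form needed for the Leibniz induction: \<open>h i j\<close> stands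
  for the product of an \<open>i\<close>-th and a \<open>j\<close>-th derivative.\<close>

lemma binomial_sum_Suc:
  fixes h :: "nat \<Rightarrow> nat \<Rightarrow> 'a::real_vector"
  shows "(\<Sum>j\<le>Suc n. real (Suc n choose j) *\<^sub>R h j (Suc n - j))
    = (\<Sum>j\<le>n. real (n choose j) *\<^sub>R (h (Suc j) (n - j) + h j (Suc n - j)))"
proof -
  \<comment> \<open>The extra top term vanishes because \<open>n choose Suc n\<close> is 0; it is
    added so that splitting off \<open>j = 0\<close> leaves a sum over
    \<open>j \<le> n\<close>.\<close>
  have "(\<Sum>j\<le>n. real (n choose j) *\<^sub>R h j (Suc n - j))
      = (\<Sum>j\<le>Suc n. real (n choose j) *\<^sub>R h j (Suc n - j))"
    by simp
  also have "\<dots> = h 0 (Suc n) + (\<Sum>j\<le>n. real (n choose Suc j) *\<^sub>R h (Suc j) (n - j))"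
    by (subst sum.atMost_Suc_shift) simp
  finally show ?thesis
    by (subst sum.atMost_Suc_shift) (simp add: sum.distrib scaleR_add_right scaleR_add_left)
qed

lemma funpow_partial_x_bounded_bilinear:
  assumes "open U" "bounded_bilinear prd" "smooth_on f U" "smooth_on g U" "p \<in> U"
  shows "(partial_x ^^ n) (\<lambda>q. prd (f q) (g q)) p
    = (\<Sum>j\<le>n. real (n choose j) *\<^sub>R prd ((partial_x ^^ j) f p) ((partial_x ^^ (n - j)) g p))"
  using assms(5)
proof (induction n arbitrary: p)
  case 0
  then show ?case by simp
next
  case (Suc n)
  note sm = smooth_on_funpow_partial(1)[OF assms(1)]
  note sf = sm[OF assms(3)] and sg = sm[OF assms(4)]
  note sp = smooth_on_bounded_bilinear[OF assms(1,2) sf sg]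
  let ?h = "\<lambda>i j. prd ((partial_x ^^ i) f p) ((partial_x ^^ j) g p)"
  have "(partial_x ^^ Suc n) (\<lambda>q. prd (f q) (g q)) p = partial_x (\<lambda>p. \<Sum>j\<le>n.
      real (n choose j) *\<^sub>R prd ((partial_x ^^ j) f p) ((partial_x ^^ (n - j)) g p)) p"
    using partial_cong(1)[OF assms(1) sm[OF smooth_on_bounded_bilinear[OF assms(1-4)]] Suc.IH Suc.prems]
    by simp
  also have "\<dots> = (\<Sum>j\<le>n. real (n choose j) *\<^sub>R (?h (Suc j) (n - j) + ?h j (Suc (n - j))))"
    using Suc.prems
    by (simp add: partial_sum(1)[where U = U] smooth_on_scaleR[OF assms(1) sp]
        partial_bounded_linear(1)[OF bounded_linear_scaleR_right sp]
        partial_bounded_bilinear(1)[OF assms(2) sf sg])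
  also have "\<dots> = (\<Sum>j\<le>n. real (n choose j) *\<^sub>R (?h (Suc j) (n - j) + ?h j (Suc n - j)))"
    by (simp add: Suc_diff_le)
  finally show ?case using binomial_sum_Suc[of n ?h] by simp
qed

section \<open>Symmetry of mixed partial derivatives\<close>

text \<open>The second difference is symmetric in the two variables, so applying this in both orders
  compares the two mixed derivatives at points near \<open>(x, t)\<close>.\<close>

lemma second_difference_mvt:
  fixes f fx fxt :: "real \<Rightarrow> real \<Rightarrow> real"
  assumes "h > 0"
    and fx: "\<And>a b. a \<in> {x..x + h} \<Longrightarrow> b \<in> {t..t + h} \<Longrightarrow>
      ((\<lambda>s. f s b) has_real_derivative fx a b) (at a)"
    and fxt: "\<And>a b. a \<in> {x..x + h} \<Longrightarrow> b \<in> {t..t + h} \<Longrightarrow>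
      (fx a has_real_derivative fxt a b) (at b)"
  shows "\<exists>a\<in>{x..x + h}. \<exists>b\<in>{t..t + h}.
    f (x + h) (t + h) - f (x + h) t - (f x (t + h) - f x t) = h * (h * fxt a b)"
proof -
  have "\<exists>a. a > x \<and> a < x + h \<and>
      (f (x + h) (t + h) - f (x + h) t) - (f x (t + h) - f x t) = (x + h - x) * (fx a (t + h) - fx a t)"
    using \<open>h > 0\<close>
    by (intro MVT2[where f = "\<lambda>s. f s (t + h) - f s t" and f' = "\<lambda>s. fx s (t + h) - fx s t"]
        DERIV_diff fx) auto
  then obtain a where a: "a > x" "a < x + h"
    "f (x + h) (t + h) - f (x + h) t - (f x (t + h) - f x t) = h * (fx a (t + h) - fx a t)"
    by auto
  have "\<exists>b. b > t \<and> b < t + h \<and> fx a (t + h) - fx a t = (t + h - t) * fxt a b"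
    using \<open>h > 0\<close> a by (intro MVT2 fxt) auto
  then obtain b where "b > t" "b < t + h" "fx a (t + h) - fx a t = h * fxt a b"
    by auto
  with a show ?thesis
    by (intro bexI[of _ a] bexI[of _ b]) auto
qed

lemma mixed_partial_eq_real:
  fixes f :: "real \<times> real \<Rightarrow> real"
  assumes "open U" "smooth_on f U" "p \<in> U"
  shows "partial_t (partial_x f) p = partial_x (partial_t f) p"
proof (rule ccontr)
  \<comment> \<open>Half the gap: a single number cannot be strictly within \<open>e\<close> of both
    mixed derivatives at \<open>p\<close>.\<close>
  define e where "e = \<bar>partial_t (partial_x f) p - partial_x (partial_t f) p\<bar> / 2"
  assume "partial_t (partial_x f) p \<noteq> partial_x (partial_t f) p"
  then have "e > 0" by (simp add: e_def)
  obtain x t where p: "p = (x, t)" by (cases p)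
  note sm = smooth_on_partial[OF assms(1)]
  have "isCont g p" if "smooth_on g U" for g :: "real \<times> real \<Rightarrow> real"
    using continuous_on_eq_continuous_at[OF assms(1), of g] smooth_on_imp_continuous_on[OF that]
      assms(3) by blast
  then have "isCont (partial_t (partial_x f)) p" "isCont (partial_x (partial_t f)) p"
    using sm assms(2) by blast+
  then have "\<exists>d>0. \<forall>q. dist q p < d \<longrightarrow>
        dist (partial_t (partial_x f) q) (partial_t (partial_x f) p) < e"
      "\<exists>d>0. \<forall>q. dist q p < d \<longrightarrow>
        dist (partial_x (partial_t f) q) (partial_x (partial_t f) p) < e"
    unfolding continuous_at_eps_delta using \<open>e > 0\<close> by simp_all
  then obtain d1 d2 where "d1 > 0" "d2 > 0"
    and d: "\<And>q. dist q p < d1 \<Longrightarrow> dist (partial_t (partial_x f) q) (partial_t (partial_x f) p) < e"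
    "\<And>q. dist q p < d2 \<Longrightarrow> dist (partial_x (partial_t f) q) (partial_x (partial_t f) p) < e"
    by blast
  obtain d3 where "d3 > 0" and d3: "\<And>q. dist q p < d3 \<Longrightarrow> q \<in> U"
    using assms open_dist by blast
  \<comment> \<open>Points of the square with side \<open>h\<close> lie within \<open>2 * h\<close>
    of \<open>p\<close>, so a third of the minimum keeps the square inside \<open>U\<close> and
    inside both continuity neighbourhoods.\<close>
  define h where "h = min d1 (min d2 d3) / 3"
  have "h > 0" using \<open>d1 > 0\<close> \<open>d2 > 0\<close> \<open>d3 > 0\<close> by (simp add: h_def)
  have near: "dist (a, b) p < min d1 (min d2 d3)" if "a \<in> {x..x + h}" "b \<in> {t..t + h}" for a b
  proof -
    have "dist (a, b) p \<le> \<bar>a - x\<bar> + \<bar>b - t\<bar>"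
      unfolding p dist_Pair_Pair dist_real_def using sqrt_sum_squares_le_sum_abs by auto
    also have "\<dots> \<le> 2 * h" using that by auto
    also have "\<dots> < min d1 (min d2 d3)" using \<open>h > 0\<close> unfolding h_def by linarith
    finally show ?thesis .
  qed
  then have U: "(a, b) \<in> U" if "a \<in> {x..x + h}" "b \<in> {t..t + h}" for a b
    using d3 that by simp
  note der = smooth_on_has_vector_derivative_partial
  note fold = has_real_derivative_iff_has_vector_derivative
  note dx = der(1)[OF assms(2) U, folded fold]
    and dxt = der(2)[OF sm(1)[OF assms(2)] U, folded fold]
    and dt = der(2)[OF assms(2) U[rotated], folded fold]
    and dtx = der(1)[OF sm(2)[OF assms(2)] U[rotated], folded fold]
  have "\<exists>a\<in>{x..x + h}. \<exists>b\<in>{t..t + h}.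
      f (x + h, t + h) - f (x + h, t) - (f (x, t + h) - f (x, t)) = h * (h * partial_t (partial_x f) (a, b))"
    by (rule second_difference_mvt[where f = "\<lambda>a b. f (a, b)" and fx = "\<lambda>a b. partial_x f (a, b)",
          OF \<open>h > 0\<close> dx dxt])
  \<comment> \<open>The same lemma with the variables exchanged; the left-hand side is the same
    second difference, grouped differently.\<close>
  moreover have "\<exists>b\<in>{t..t + h}. \<exists>a\<in>{x..x + h}.
      f (x + h, t + h) - f (x, t + h) - (f (x + h, t) - f (x, t)) = h * (h * partial_x (partial_t f) (a, b))"
    by (rule second_difference_mvt[where f = "\<lambda>b a. f (a, b)" and fx = "\<lambda>b a. partial_t f (a, b)",
          OF \<open>h > 0\<close> dt dtx])
  ultimately obtain a b a' b' where ab: "a \<in> {x..x + h}" "b \<in> {t..t + h}"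
    "a' \<in> {x..x + h}" "b' \<in> {t..t + h}"
    and eq: "f (x + h, t + h) - f (x + h, t) - (f (x, t + h) - f (x, t))
        = h * (h * partial_t (partial_x f) (a, b))"
      "f (x + h, t + h) - f (x, t + h) - (f (x + h, t) - f (x, t))
        = h * (h * partial_x (partial_t f) (a', b'))"
    by blast
  have "h * (h * partial_t (partial_x f) (a, b)) = h * (h * partial_x (partial_t f) (a', b'))"
    using eq by linarith
  then have "partial_t (partial_x f) (a, b) = partial_x (partial_t f) (a', b')"
    using \<open>h > 0\<close> by simp
  moreover have "dist (partial_t (partial_x f) (a, b)) (partial_t (partial_x f) p) < e"
    "dist (partial_x (partial_t f) (a', b')) (partial_x (partial_t f) p) < e"
    using near ab by (auto intro: d)
  ultimately show False unfolding e_def dist_real_def by argo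
qed

text \<open>Reduction to the scalar case: pairing with a fixed \<open>w\<close> is bounded linear,
  hence commutes with both partial derivatives, and the inner products with all \<open>w\<close>
  determine a vector.\<close>

lemma mixed_partial_eq:
  fixes f :: "real \<times> real \<Rightarrow> 'a::real_inner"
  assumes "open U" "smooth_on f U" "p \<in> U"
  shows "partial_t (partial_x f) p = partial_x (partial_t f) p"
proof (rule vector_eq_rdot[THEN iffD1, OF allI])
  fix w
  note sm = smooth_on_partial[OF assms(1)]
  note bl = bounded_linear_inner_left[of w]
  note L = partial_bounded_linear[OF bl]
  note sw = smooth_on_bounded_linear[OF assms(1) bl]
  have "partial_t (partial_x f) p \<bullet> w = partial_t (\<lambda>q. partial_x f q \<bullet> w) p"
    by (rule L(2)[OF sm(1)[OF assms(2)] assms(3), symmetric])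
  also have "\<dots> = partial_t (partial_x (\<lambda>q. f q \<bullet> w)) p"
    by (rule partial_cong(2)[OF assms(1) sw[OF sm(1)[OF assms(2)]] L(1)[OF assms(2), symmetric]
          assms(3)])
  also have "\<dots> = partial_x (partial_t (\<lambda>q. f q \<bullet> w)) p"
    by (rule mixed_partial_eq_real[OF assms(1) sw[OF assms(2)] assms(3)])
  also have "\<dots> = partial_x (\<lambda>q. partial_t f q \<bullet> w) p"
    by (rule partial_cong(1)[OF assms(1) sm(2)[OF sw[OF assms(2)]] L(2)[OF assms(2)] assms(3)])
  also have "\<dots> = partial_x (partial_t f) p \<bullet> w"
    by (rule L(1)[OF sm(2)[OF assms(2)] assms(3)])
  finally show "partial_t (partial_x f) p \<bullet> w = partial_x (partial_t f) p \<bullet> w" .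
qed

lemma partial_t_funpow_partial_x:
  fixes f :: "real \<times> real \<Rightarrow> 'a::real_inner"
  assumes "open U" "smooth_on f U" "p \<in> U"
  shows "partial_t ((partial_x ^^ n) f) p = (partial_x ^^ n) (partial_t f) p"
  using assms(3)
proof (induction n arbitrary: p)
  case 0
  then show ?case by simp
next
  case (Suc n)
  note sm = smooth_on_funpow_partial(1)[OF assms(1,2)]
  show ?case
    using mixed_partial_eq[OF assms(1) sm Suc.prems]
      partial_cong(1)[OF assms(1) smooth_on_partial(2)[OF assms(1) sm] Suc.IH Suc.prems] by simp
qed

section \<open>The recursion\<close>

lemma smooth_on_coeff_D:
  assumes "open U" "smooth_on A U" "smooth_on B U"
  shows "smooth_on (coeff_D A B n k) U"
proof -
  have "smooth_on (\<lambda>p. if k \<le> n - 1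
      then real ((n - 1 - 1) choose (n - 1 - k)) *\<^sub>R (partial_x ^^ (n - 1 - k)) B p else 0) U"
    by (cases "k \<le> n - 1")
      (auto intro!: smooth_on_scaleR smooth_on_const smooth_on_funpow_partial assms)
  then show ?thesis
    unfolding coeff_D_def[abs_def] Let_def
    by (intro smooth_on_diff smooth_on_scaleR smooth_on_funpow_partial assms)
qed

lemma coeff_C_Suc:
  assumes "k \<ge> 1" "1 \<le> l" "l \<le> k"
  shows "coeff_C A B (Suc k) l = (\<lambda>p. partial_t (coeff_C A B k l) p
    + (\<Sum>m = l - 1..k. coeff_C A B k m p ** coeff_D A B (m + 1) l p))"
  using assms by (cases k) auto

lemma coeff_C_Suc_diag:
  "k \<ge> 1 \<Longrightarrow>
    coeff_C A B (Suc k) (Suc k) = (\<lambda>p. coeff_C A B k k p ** coeff_D A B (Suc k) (Suc k) p)"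
  by (cases k) auto

text \<open>The case \<open>l = 0\<close> makes the \<open>m = 0\<close> term of the recursion
  vanish, which the reordering of sums in the main induction relies on.\<close>

lemma coeff_C_eq_0: "l = 0 \<or> k < l \<Longrightarrow> coeff_C A B k l = (\<lambda>p. 0)"
  by (induction A B k l rule: coeff_C.induct) (auto simp: Let_def)

text \<open>Needed to differentiate the coefficients in t. The induction keeps \<open>l\<close>
  arbitrary since row \<open>Suc k\<close> draws on several entries of row \<open>k\<close>.\<close>

lemma smooth_on_coeff_C:
  assumes "open U" "smooth_on A U" "smooth_on B U"
  shows "smooth_on (coeff_C A B k l) U"
proof (induction k arbitrary: l)
  case 0
  then show ?case by (simp add: smooth_on_const)
next
  case (Suc k)
  note mult = smooth_on_bounded_bilinear[OF assms(1) bounded_bilinear_matrix_matrix_mult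
      Suc.IH smooth_on_coeff_D[OF assms]]
  consider "k = 0" | "l = 0 \<or> Suc k < l" | "k \<ge> 1" "1 \<le> l" "l \<le> k" | "k \<ge> 1" "l = Suc k"
    by linarith
  then show ?case
  proof cases
    case 1
    then show ?thesis by (simp add: smooth_on_const smooth_on_minus[OF assms(1,2)])
  next
    case 2
    then show ?thesis by (simp only: coeff_C_eq_0 smooth_on_const)
  next
    case 3
    show ?thesis unfolding coeff_C_Suc[OF 3]
      by (intro smooth_on_add smooth_on_sum smooth_on_partial mult assms(1) Suc.IH)
  next
    case 4
    show ?thesis unfolding 4(2) coeff_C_Suc_diag[OF 4(1)] by (rule mult)
  qed
qed

section \<open>The system and its source term\<close>

locale balance_law =
  fixes \<Omega> :: "(real \<times> real) set"
    and S :: "real^'n \<Rightarrow> real^'n"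
    and A B :: "real \<times> real \<Rightarrow> real^'n^'n"
    and Q :: "real \<times> real \<Rightarrow> real^'n"
  assumes open_dom: "open \<Omega>"
    and smooth_S: "smooth_on S UNIV"
    and smooth_A: "smooth_on A \<Omega>"
    and smooth_Q: "smooth_on Q \<Omega>"
    and pde: "\<And>p. p \<in> \<Omega> \<Longrightarrow> partial_t Q p = - (A p *v partial_x Q p) + S (Q p)"
    and B_eq: "\<And>p. p \<in> \<Omega> \<Longrightarrow> B p = jacobian S (at (Q p))"
begin

text \<open>On \<open>\<Omega>\<close>, \<open>B\<close> is the smooth Jacobian of \<open>S\<close>
  composed with \<open>Q\<close>.\<close>

lemma smooth_B: "smooth_on B \<Omega>"
  using smooth_on_cong[OF open_dom B_eq[symmetric]
      smooth_on_compose[OF open_dom open_UNIV subset_UNIV smooth_on_jacobian[OF open_UNIV smooth_S]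
        smooth_Q]] .

lemma smooth_SQ: "smooth_on (\<lambda>p. S (Q p)) \<Omega>"
  by (rule smooth_on_compose[OF open_dom open_UNIV subset_UNIV smooth_S smooth_Q])

lemmas smooth_mult_vec = smooth_on_bounded_bilinear[OF open_dom bounded_bilinear_matrix_vector_mult]
lemmas smooth_px = smooth_on_funpow_partial(1)[OF open_dom smooth_Q]

text \<open>Chain rule, with the Jacobian acting as the total derivative of \<open>S\<close>. The
  x-version feeds the Leibniz rule, the t-version the first step of the remainder.\<close>

lemma partial_source:
  assumes "p \<in> \<Omega>"
  shows "partial_x (\<lambda>q. S (Q q)) p = B p *v partial_x Q p"
    and "partial_t (\<lambda>q. S (Q q)) p = B p *v partial_t Q p"
proof -
  have "(S has_derivative (\<lambda>h. B p *v h)) (at (Q p))"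
    using smooth_on_has_derivative[OF smooth_S UNIV_I] jacobian_works[of S "at (Q p)"] B_eq[OF assms]
    by (auto intro: differentiableI)
  from partial_eq_frechet_derivative[OF has_derivative_compose[OF
        smooth_on_has_derivative[OF smooth_Q assms] this]]
  show "partial_x (\<lambda>q. S (Q q)) p = B p *v partial_x Q p"
    and "partial_t (\<lambda>q. S (Q q)) p = B p *v partial_t Q p"
    using smooth_on_partial_eq[OF smooth_Q assms] by simp_all
qed

lemma partial_t_funpow_partial_x_Q:
  assumes "p \<in> \<Omega>" "m \<ge> 1"
  shows "partial_t ((partial_x ^^ m) Q) p
    = (\<Sum>k = 1..m + 1. coeff_D A B (m + 1) k p *v (partial_x ^^ k) Q p)"
proof -
  note sAQ = smooth_mult_vec[OF smooth_A smooth_on_partial(1)[OF open_dom smooth_Q]]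
  note sBQ = smooth_mult_vec[OF smooth_B smooth_on_partial(1)[OF open_dom smooth_Q]]
  note leibniz = funpow_partial_x_bounded_bilinear[OF open_dom bounded_bilinear_matrix_vector_mult
      _ smooth_on_partial(1)[OF open_dom smooth_Q] assms(1)]
  let ?X = "\<lambda>k. (partial_x ^^ k) Q p"
  let ?a = "\<lambda>k. real (m choose (m + 1 - k)) *\<^sub>R ((partial_x ^^ (m + 1 - k)) A p *v ?X k)"
  let ?b = "\<lambda>k. real ((m - 1) choose (m - k)) *\<^sub>R ((partial_x ^^ (m - k)) B p *v ?X k)"
  obtain n where m: "m = Suc n" using assms(2) by (cases m) auto
  have "partial_t ((partial_x ^^ m) Q) p = (partial_x ^^ m) (partial_t Q) p"
    by (rule partial_t_funpow_partial_x[OF open_dom smooth_Q assms(1)])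
  also have "\<dots> = (partial_x ^^ m) (\<lambda>q. S (Q q) - A q *v partial_x Q q) p"
    using pde by (intro funpow_partial_x_cong[OF open_dom _ _ assms(1)]
        smooth_on_partial open_dom smooth_Q) simp
  also have "\<dots> = (partial_x ^^ m) (\<lambda>q. S (Q q)) p - (partial_x ^^ m) (\<lambda>q. A q *v partial_x Q q) p"
    by (rule funpow_partial_x_diff[OF open_dom smooth_SQ sAQ assms(1)])
  \<comment> \<open>One of the \<open>m = Suc n\<close> derivatives is spent on the chain rule,
    which is why \<open>m \<ge> 1\<close> is assumed and why the \<open>B\<close>-terms carry
    binomials of \<open>m - 1\<close>.\<close>
  also have "(partial_x ^^ m) (\<lambda>q. S (Q q)) p = (partial_x ^^ n) (\<lambda>q. B q *v partial_x Q q) p"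
    unfolding m funpow_Suc_right o_apply
    by (rule funpow_partial_x_cong[OF open_dom smooth_on_partial(1)[OF open_dom smooth_SQ]
          partial_source(1) assms(1)])
  also have "\<dots> = (\<Sum>j\<le>n. real (n choose j) *\<^sub>R ((partial_x ^^ j) B p *v ?X (Suc (n - j))))"
    unfolding leibniz[OF smooth_B] by (simp add: funpow_swap1)
  \<comment> \<open>Reindexing by the order \<open>k = m - j\<close> of the derivative of
    \<open>Q\<close>; for the \<open>A\<close>-terms below it is
    \<open>k = m + 1 - j\<close>.\<close>
  also have "\<dots> = (\<Sum>k = 1..m. ?b k)"
    by (rule sum.reindex_bij_witness[where i = "\<lambda>k. m - k" and j = "\<lambda>j. m - j"])
      (auto simp: m Suc_diff_le)
  also have "(partial_x ^^ m) (\<lambda>q. A q *v partial_x Q q) p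
      = (\<Sum>j\<le>m. real (m choose j) *\<^sub>R ((partial_x ^^ j) A p *v ?X (Suc (m - j))))"
    unfolding leibniz[OF smooth_A] by (simp add: funpow_swap1)
  also have "\<dots> = (\<Sum>k = 1..m + 1. ?a k)"
    by (rule sum.reindex_bij_witness[where i = "\<lambda>k. m + 1 - k" and j = "\<lambda>j. m + 1 - j"])
      (auto simp: Suc_diff_le)
  \<comment> \<open>Padding by a zero term at \<open>k = m + 1\<close> gives both sums the same
    range and matches the conditional in \<open>coeff_D\<close>.\<close>
  also have "(\<Sum>k = 1..m. ?b k) = (\<Sum>k = 1..m + 1. if k \<le> m then ?b k else 0)"
    by simp
  also have "\<dots> - (\<Sum>k = 1..m + 1. ?a k)
      = (\<Sum>k = 1..m + 1. coeff_D A B (m + 1) k p *v ?X k)"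
    unfolding sum_subtractf[symmetric] coeff_D_def Let_def
    by (intro sum.cong refl)
      (auto simp: matrix_vector_mult_diff_rdistrib scaleR_matrix_vector_assoc)
  finally show ?thesis .
qed

text \<open>The separate case \<open>k = 1\<close> encodes the convention for the derivative of
  order -1, since \<open>k - 2\<close> is truncated to 0 there.\<close>

definition remainder :: "nat \<Rightarrow> real \<times> real \<Rightarrow> real^'n" where
  "remainder k = (if k = 1 then (\<lambda>p. S (Q p))
     else (partial_t ^^ (k - 2)) (\<lambda>q. B q *v partial_t Q q))"

lemma smooth_remainder: "smooth_on (remainder k) \<Omega>"
  unfolding remainder_def
  using smooth_SQ smooth_on_funpow_partial(2)[OF open_dom
      smooth_mult_vec[OF smooth_B smooth_on_partial(2)[OF open_dom smooth_Q]]] by simp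

lemma partial_t_remainder:
  assumes "k \<ge> 1" "p \<in> \<Omega>"
  shows "partial_t (remainder k) p = remainder (Suc k) p"
proof (cases "k = 1")
  case True
  then show ?thesis using partial_source(2)[OF assms(2)] by (simp add: remainder_def)
next
  case False
  then obtain j where "k = Suc (Suc j)" using assms(1) by (cases k; cases "k - 1") auto
  then show ?thesis by (simp add: remainder_def)
qed

lemma funpow_partial_t_expansion:
  assumes "k \<ge> 1" "p \<in> \<Omega>"
  shows "(partial_t ^^ k) Q p
    = (\<Sum>l = 1..k. coeff_C A B k l p *v (partial_x ^^ l) Q p) + remainder k p"
  using assms
proof (induction k arbitrary: p rule: nat_induct_at_least)
  \<comment> \<open>The differential equation itself, as the only coefficient is \<open>- A\<close>
    and the remainder is \<open>S (Q p)\<close>.\<close>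
  case base
  then show ?case
    using pde by (simp add: remainder_def bounded_bilinear.minus_left[OF bounded_bilinear_matrix_vector_mult])
next
  case (Suc k)
  let ?C = "coeff_C A B" and ?D = "coeff_D A B"
  let ?X = "\<lambda>l. (partial_x ^^ l) Q"
  note sC = smooth_on_coeff_C[OF open_dom smooth_A smooth_B, of k]
  have sCX: "smooth_on (\<lambda>p. ?C k l p *v ?X l p) \<Omega>" for l
    by (rule smooth_mult_vec[OF sC smooth_px])
  \<comment> \<open>The induction hypothesis holds at every point of the open set
    \<open>\<Omega>\<close>, hence may be differentiated in t.\<close>
  have "(partial_t ^^ Suc k) Q p
      = partial_t (\<lambda>p. (\<Sum>l = 1..k. ?C k l p *v ?X l p) + remainder k p) p"
    using partial_cong(2)[OF open_dom smooth_on_funpow_partial(2)[OF open_dom smooth_Q]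
        Suc.IH Suc.prems] by simp
  also have "\<dots> = (\<Sum>l = 1..k. partial_t (\<lambda>p. ?C k l p *v ?X l p) p) + remainder (Suc k) p"
    using partial_add(2)[OF smooth_on_sum[where I = "{1..k}", OF open_dom sCX] smooth_remainder,
        OF Suc.prems, of "\<lambda>l. l" k]
      partial_sum(2)[where I = "{1..k}", OF sCX Suc.prems, of "\<lambda>l. l"]
      partial_t_remainder[OF Suc.hyps Suc.prems] by simp
  also have "(\<Sum>l = 1..k. partial_t (\<lambda>p. ?C k l p *v ?X l p) p)
      = (\<Sum>l = 1..k. partial_t (?C k l) p *v ?X l p) + (\<Sum>m = 1..k. ?C k m p *v partial_t (?X m) p)"
    by (simp add: partial_bounded_bilinear(2)[OF bounded_bilinear_matrix_vector_mult sC smooth_px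
          Suc.prems] sum.distrib)
  also have "(\<Sum>m = 1..k. ?C k m p *v partial_t (?X m) p)
      = (\<Sum>m = 1..k. \<Sum>l = 1..m + 1. (?C k m p ** ?D (m + 1) l p) *v ?X l p)"
    by (intro sum.cong refl)
      (simp add: partial_t_funpow_partial_x_Q[OF Suc.prems] matrix_vector_mul_assoc
        bounded_bilinear.sum_right[OF bounded_bilinear_matrix_vector_mult]
        del: sum.cl_ivl_Suc)
  \<comment> \<open>The added \<open>m = 0\<close> term is zero. With it, exchanging the triangular
    sums gives the range \<open>l - 1..k\<close> for every \<open>l\<close>, including
    \<open>l = 1\<close>.\<close>
  also have "\<dots> = (\<Sum>m = 0..k. \<Sum>l = 1..m + 1. (?C k m p ** ?D (m + 1) l p) *v ?X l p)"
    by (rule sum.mono_neutral_left) (auto simp: coeff_C_eq_0)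
  also have "\<dots> = (\<Sum>l = 1..Suc k. \<Sum>m = l - 1..k. (?C k m p ** ?D (m + 1) l p) *v ?X l p)"
    unfolding sum.Sigma[OF finite_atLeastAtMost ballI[OF finite_atLeastAtMost]]
    by (rule sum.reindex_bij_witness[where i = prod.swap and j = prod.swap]) auto
  \<comment> \<open>For \<open>l = Suc k\<close> only \<open>m = k\<close> remains, which is the
    diagonal clause of the recursion.\<close>
  also have "\<dots> = (\<Sum>l = 1..k. \<Sum>m = l - 1..k. (?C k m p ** ?D (m + 1) l p) *v ?X l p)
      + ?C (Suc k) (Suc k) p *v ?X (Suc k) p"
    using Suc.hyps by (simp add: coeff_C_Suc_diag)
  \<comment> \<open>For \<open>l \<le> k\<close> the differentiated coefficient and the inner sum
    combine into the off-diagonal clause.\<close>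
  also have "(\<Sum>l = 1..k. partial_t (?C k l) p *v ?X l p) + \<dots>
      = (\<Sum>l = 1..k. ?C (Suc k) l p *v ?X l p) + ?C (Suc k) (Suc k) p *v ?X (Suc k) p"
    unfolding add.assoc[symmetric] sum.distrib[symmetric] using Suc.hyps
    by (intro arg_cong2[where f = "(+)"] sum.cong refl)
      (simp add: coeff_C_Suc matrix_vector_mult_add_rdistrib
        bounded_bilinear.sum_left[OF bounded_bilinear_matrix_vector_mult])
  also have "\<dots> = (\<Sum>l = 1..Suc k. ?C (Suc k) l p *v ?X l p)"
    by simp
  finally show ?case .
qed

end

theorem proposition3p2:
  fixes \<Omega> :: "(real \<times> real) set"
    and S :: "real^'n \<Rightarrow> real^'n"
    and A B :: "real \<times> real \<Rightarrow> real^'n^'n"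
    and Q :: "real \<times> real \<Rightarrow> real^'n"
    and k :: nat
  assumes "open \<Omega>"
    and "smooth_on S UNIV"
    and "smooth_on A \<Omega>"
    and "smooth_on Q \<Omega>"
    and "\<And>p. p \<in> \<Omega> \<Longrightarrow> partial_t Q p = - (A p *v partial_x Q p) + S (Q p)"
    and "\<And>p. p \<in> \<Omega> \<Longrightarrow> B p = jacobian S (at (Q p))"
    and "k \<ge> 1"
  shows "\<forall>p\<in>\<Omega>. (partial_t ^^ k) Q p =
           (\<Sum>l = 1..k. coeff_C A B k l p *v (partial_x ^^ l) Q p)
           + (if k = 1 then S (Q p)
              else (partial_t ^^ (k - 2)) (\<lambda>q. B q *v partial_t Q q) p)"
proof -
  interpret balance_law \<Omega> S A B Q by unfold_locales fact+
  show ?thesis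
    using funpow_partial_t_expansion[OF assms(7)] by (simp add: remainder_def)
qed

end
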